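(* Let $\mathcal{X}\subseteq\mathbb{R}^d$ be a closed set, let $G\colon\mathcal{X}\rightrightarrows\mathbb{R}^d$ be a set-valued map, and let $\{x_k\}_{k\ge1},\{y_k\}_{k\ge 1},\{\xi_k\}_{k\ge 1}\subset\mathbb{R}^d$ and $\alpha_k>0$ satisfy $x_{k+1}=x_k+\alpha_k(y_k+\xi_k)$ for all $k\ge 1$. Suppose that: 1. all limit points of $\{x_k\}$ lie in $\mathcal{X}$; 2. $\sup_{k\ge1}\|x_k\|<\infty$ and $\sup_{k\ge1}\|y_k\|<\infty$; 3. $\sum_{k=1}^\infty\alpha_k=\infty$ and $\sum_{k=1}^\infty\alpha_k^2<\infty$; 4. the sums $\sum_{k=1}^n\alpha_k\xi_k$ converge to some vector $v$ as $n\to\infty$; 5. for any unbounded increasing sequence $\{k_j\}\subset\mathbb{N}$ such that $x_{k_j}$ converges to some point $\bar x$, one has $\lim_{n\to\infty}\mathrm{dist}\big(\frac1n\sum_{j=1}^n y_{k_j},\,G(\bar x)\big)=0$. Suppose moreover that there exists a continuous function $\varphi\colon\mathbb{R}^d\to\mathbb{R}$, bounded from below, such that: (a) (Weak Sard) for a dense set of values $r\in\mathbb{R}$, the intersection $\varphi^{-1}(r)\cap G^{-1}(0)$ is empty; (b) (Descent) whenever $z\colon\mathbb{R}_+\to\mathbb{R}^d$ is a trajectory of the differential inclusion $\dot z(t)\in G(z(t))$ for a.e. $t\ge0$, and $0\notin G(z(0))$, there exists a real $T>0$ satisfying $\varphi(z(T))<\sup_{t\in[0,T]}\varphi(z(t))\le\varphi(z(0))$.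 Then every limit point of $\{x_k\}_{k\ge1}$ lies in $G^{-1}(0)$, and the function values $\{\varphi(x_k)\}_{k\ge1}$ converge.
   Context: Here $\mathbb{R}^d$ carries an inner product and its induced norm; $\mathrm{dist}(x;Q)=\min_{y\in Q}\|y-x\|$ denotes the distance of a point $x$ to a set $Q\subset\mathbb{R}^d$. A set-valued map $G\colon\mathcal{X}\rightrightarrows\mathbb{R}^d$ assigns to each $x\in\mathcal{X}$ a subset $G(x)\subseteq\mathbb{R}^d$, and $G^{-1}(v)=\{x\in\mathcal{X}: v\in G(x)\}$. An arc is a curve $z\colon\mathbb{R}_+\to\mathbb{R}^d$ that is absolutely continuous, i.e. $z(t)=z(0)+\int_0^t y(\tau)\,d\tau$ for all $t\geq 0$ for some $y$ integrable on compact intervals (then $y=\dot z$ a.e.). A trajectory of $G$ is an arc $z$ with $\dot z(t)\in G(z(t))$ for a.e. $t\ge0$ (its image lies in $\mathcal{X}$). A limit point of a sequence is a limit of some subsequence.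
   Formalization: The formal version requires G(x̄) to be nonempty and closed at each limit point x̄ of the iterates, so that the minimum defining dist(·;G(x̄)) exists at every point; without closedness the claim fails (G(x)=[-1,0), φ=exp, y_k=-1/k, α_k=1/k, ξ_k=0). *)

theory Defs
  imports "HOL-Analysis.Analysis"
begin

definition limit_point :: "(nat \<Rightarrow> 'a::topological_space) \<Rightarrow> 'a \<Rightarrow> bool" where
  "limit_point x p \<longleftrightarrow> (\<exists>r. strict_mono r \<and> (\<lambda>j. x (r j)) \<longlonglongrightarrow> p)"

text \<open>A set-valued map on X is a function G into sets, of which only the values on X matter;
  hence inverses and trajectories refer to X explicitly.\<close>

definition setval_inverse :: "'a set \<Rightarrow> ('a \<Rightarrow> 'b set) \<Rightarrow> 'b \<Rightarrow> 'a set" where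
  "setval_inverse X G v = {x \<in> X. v \<in> G x}"

text \<open>Curves on the half-line are total functions on the reals; nothing is said about
  negative times.\<close>

definition ac_curve :: "(real \<Rightarrow> 'a::euclidean_space) \<Rightarrow> bool" where
  "ac_curve z \<longleftrightarrow>
     (\<exists>y. \<forall>t\<ge>0. y absolutely_integrable_on {0..t} \<and> z t = z 0 + integral {0..t} y)"

definition trajectory ::
    "'a set \<Rightarrow> ('a \<Rightarrow> 'a set) \<Rightarrow> (real \<Rightarrow> 'a::euclidean_space) \<Rightarrow> bool" where
  "trajectory X G z \<longleftrightarrow>
     ac_curve z \<and> (\<forall>t\<ge>0. z t \<in> X) \<and>
     (AE t in lebesgue. 0 \<le> t \<longrightarrow> (\<exists>v \<in> G (z t). (z has_vector_derivative v) (at t)))"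

text \<open>The distance to a set Q is a minimum over Q, so it presupposes that this minimum exists
  at every point. When it does, it is the library's \<^const>\<open>infdist\<close>. Without this
  proviso \<^const>\<open>infdist\<close> would be 0 for empty Q, and would be an unattained
  infimum for Q that is not closed.\<close>

definition dist_attained :: "'a::real_normed_vector set \<Rightarrow> bool" where
  "dist_attained Q \<longleftrightarrow> (\<forall>w. \<exists>y\<in>Q. \<forall>y'\<in>Q. norm (y - w) \<le> norm (y' - w))"

lemma dist_attained_iff:
  fixes Q :: "'a::euclidean_space set"
  shows "dist_attained Q \<longleftrightarrow> closed Q \<and> Q \<noteq> {}"
proof
  assume a: "dist_attained Q"
  have "w \<in> Q" if "w \<in> closure Q" for w
  proof -
    obtain y where y: "y \<in> Q" "\<And>y'. y' \<in> Q \<Longrightarrow> norm (y - w) \<le> norm (y' - w)"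
      using a unfolding dist_attained_def by meson
    have "norm (y - w) \<le> e" if "e > 0" for e
      using \<open>w \<in> closure Q\<close> y(2) that unfolding closure_approachable dist_norm
      by (meson less_imp_le order_trans)
    then have "norm (y - w) \<le> 0"
      by (rule field_le_epsilon[where y=0, simplified])
    then show ?thesis using y(1) by simp
  qed
  then have "closed Q" by (metis closure_subset closure_closed subsetI subset_antisym closed_closure)
  moreover have "Q \<noteq> {}" using a unfolding dist_attained_def by blast
  ultimately show "closed Q \<and> Q \<noteq> {}" by blast
next
  assume a: "closed Q \<and> Q \<noteq> {}"
  show "dist_attained Q"
    unfolding dist_attained_def
  proof
    fix w
    show "\<exists>y\<in>Q. \<forall>y'\<in>Q. norm (y - w) \<le> norm (y' - w)"
      using a distance_attains_inf[of Q w] by (metis dist_norm norm_minus_commute)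
  qed
qed

end

(* The iterates, corrected by the tail of the convergent noise series and interpolated at the times
   t_k = alpha_1 + ... + alpha_(k-1), form a Lipschitz curve W. Its time shifts W(s_n + .), s_n -> oo,
   have locally uniform limits z along subsequences, and z is a trajectory of G: if w = z'(t), then for
   every direction d there are arbitrarily late k with x_k near z(t) and d . y_k at most slightly
   above d . w, which allows one to select a subsequence along which the averages of y tend to w;
   hypothesis 5 puts w into the closed set G(z(t)).

   If phi o W had no limit, it would cross some interval [a, b] upwards infinitely often, with a
   noncritical by weak Sard. Shifting to the last times at level a before reaching b produces a
   trajectory z with phi(z(0)) = a that has to descend below a before it can reach b, a contradiction.
   So phi o W converges, phi is constant on the limit trajectory issued from any limit point, and by
   the descent property that point is critical. *)

theory Submission
  imports Defs "HOL-Complex_Analysis.Great_Picard"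
begin

section \<open>Lipschitz curves\<close>

text \<open>\<open>G t = g t + (M + 1) t\<close> is a bi-Lipschitz homeomorphism, so the measure \<open>A \<mapsto> |G ` A|\<close> is absolutely
  continuous, and its Radon-Nikodym density is the density of \<open>G\<close>.\<close>

lemma lipschitz_on_real_has_density:
  fixes g :: "real \<Rightarrow> real"
  assumes lip: "M-lipschitz_on UNIV g"
  shows "\<exists>\<rho>. \<forall>a b. a \<le> b \<longrightarrow> \<rho> absolutely_integrable_on {a..b} \<and> (\<rho> has_integral (g b - g a)) {a..b}"
proof -
  \<comment> \<open>Difference quotients of \<open>g\<close> lie in \<open>[-M, M]\<close>, so those
    of \<open>G\<close> lie in \<open>[1, 2 * M + 1]\<close>: the lower bound makes \<open>G\<close>
    invertible, the upper one keeps null sets null.\<close>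
  define G where "G t = g t + (M + 1) * t" for t
  have bound: "\<bar>g s - g t\<bar> \<le> M * \<bar>s - t\<bar>" for s t
    using lipschitz_onD[OF lip, of s t] by (simp add: dist_real_def)
  have "M \<ge> 0" using lip by (rule lipschitz_on_nonneg)
  have incr: "G t - G s \<ge> t - s" if "s \<le> t" for s t
    using bound[of t s] that by (simp add: G_def algebra_simps)
  have Glip: "\<bar>G s - G t\<bar> \<le> (2 * M + 1) * \<bar>s - t\<bar>" for s t
  proof -
    have "\<bar>G s - G t\<bar> \<le> \<bar>g s - g t\<bar> + \<bar>(M + 1) * (s - t)\<bar>"
      unfolding G_def by (simp add: algebra_simps)
    also have "\<dots> \<le> M * \<bar>s - t\<bar> + (M + 1) * \<bar>s - t\<bar>"
      using bound[of s t] \<open>M \<ge> 0\<close> by (simp add: abs_mult)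
    finally show ?thesis by (simp add: algebra_simps)
  qed
  have contG: "continuous_on UNIV G"
    unfolding G_def using lipschitz_on_continuous_on[OF lip] by (intro continuous_intros)
  have smG: "s \<le> t \<longleftrightarrow> G s \<le> G t" for s t
    using incr[of s t] incr[of t s] by linarith
  have "inj G" by (rule injI) (metis smG order_antisym order_refl)
  have "surj G"
  unfolding surj_def
  proof
    fix u :: real
    define R where "R = \<bar>u - G 0\<bar>"
    have "G (-R) \<le> u" "u \<le> G R" using incr[of "-R" 0] incr[of 0 R] by (auto simp: R_def)
    then show "\<exists>t. u = G t"
      using IVT'[of G "-R" u R] continuous_on_subset[OF contG] by (auto simp: R_def)
  qed
  define h where "h = inv G"
  have hG [simp]: "h (G t) = t" for t using \<open>inj G\<close> by (simp add: h_def)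
  have Gh [simp]: "G (h t) = t" for t using \<open>surj G\<close> by (simp add: h_def surj_f_inv_f)
  have vim: "h -` A = G ` A" for A
  proof safe
    fix u assume "h u \<in> A"
    then show "u \<in> G ` A" by (rule image_eqI[rotated]) simp
  qed simp
  \<comment> \<open>Monotonicity makes \<open>h\<close> measurable. Images of Borel sets under
    \<open>G\<close> are preimages under \<open>h\<close>, hence Borel as well.\<close>
  have "mono h" by (rule monoI) (subst smG, simp)
  then have h_meas [measurable]: "h \<in> borel_measurable borel" by (rule borel_measurable_mono)
  define \<mu> where "\<mu> = distr lborel borel h"
  have em: "emeasure \<mu> A = emeasure lborel (G ` A)" if "A \<in> sets borel" for A
    using that by (simp add: \<mu>_def emeasure_distr vim)
  have "absolutely_continuous lborel \<mu>"
    unfolding absolutely_continuous_def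
  proof
    fix A :: "real set" assume A: "A \<in> null_sets lborel"
    then have "A \<in> sets borel" by auto
    have "negligible A"
      using null_sets_completionI[OF A] by (simp add: negligible_iff_null_sets)
    have "negligible (G ` A)"
    proof (rule negligible_locally_Lipschitz_image[OF _ \<open>negligible A\<close>])
      fix t
      show "\<exists>T B. open T \<and> t \<in> T \<and> (\<forall>s\<in>A \<inter> T. norm (G s - G t) \<le> B * norm (s - t))"
        by (intro exI[of _ UNIV] exI[of _ "2 * M + 1"]) (simp add: Glip)
    qed simp
    \<comment> \<open>\<open>negligible\<close> refers to the completed measure; Borel measurability
      of the image brings the conclusion back to \<open>lborel\<close>.\<close>
    moreover have "G ` A \<in> sets lborel"
      using measurable_sets[OF h_meas \<open>A \<in> sets borel\<close>] by (simp add: vim)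
    ultimately have "emeasure lborel (G ` A) = 0"
      using null_sets_completion_iff[of "G ` A" lborel] by (auto simp: negligible_iff_null_sets)
    then show "A \<in> null_sets \<mu>"
      using em \<open>A \<in> sets borel\<close> by (simp add: null_sets_def \<mu>_def)
  qed
  then obtain \<rho> where \<rho> [measurable]: "\<rho> \<in> borel_measurable lborel" and dens: "density lborel \<rho> = \<mu>"
    using sigma_finite_measure.Radon_Nikodym[OF sigma_finite_lborel, of \<mu>] by (auto simp: \<mu>_def)
  define f where "f t = enn2real (\<rho> t)" for t
  have [measurable]: "f \<in> borel_measurable borel" unfolding f_def by measurable
  have f: "(f has_integral (G b - G a)) {a..b}" if "a \<le> b" for a b
  proof -
    have "G ` {a..b} = {G a..G b}"
    proof safe
      fix t assume "t \<in> {a..b}"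
      then show "G t \<in> {G a..G b}" using smG[of a t] smG[of t b] by auto
    next
      fix u assume "u \<in> {G a..G b}"
      then have "h u \<in> {a..b}" using smG[of a "h u"] smG[of "h u" b] by auto
      then show "u \<in> G ` {a..b}" by (rule image_eqI[rotated]) simp
    qed
    then have "emeasure \<mu> {a..b} = ennreal (G b - G a)"
      using smG[of a b] that by (simp add: em)
    then have I: "(\<integral>\<^sup>+t. \<rho> t * indicator {a..b} t \<partial>lborel) = ennreal (G b - G a)"
      unfolding dens[symmetric] by (simp add: emeasure_density)
    \<comment> \<open>\<open>enn2real\<close> turns infinity into 0, so \<open>f\<close> can replace
      \<open>\<rho>\<close> only where the density is finite. The finite integral over the interval
      ensures this almost everywhere.\<close>
    have "AE t in lborel. \<rho> t * indicator {a..b} t \<noteq> \<infinity>"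
      by (rule nn_integral_PInf_AE) (auto simp: I)
    then have "(\<integral>\<^sup>+t. ennreal (f t * indicator {a..b} t) \<partial>lborel) = (\<integral>\<^sup>+t. \<rho> t * indicator {a..b} t \<partial>lborel)"
      by (intro nn_integral_cong_AE) (auto simp: f_def indicator_def top.not_eq_extremum)
    then have "((\<lambda>t. f t * indicator {a..b} t) has_integral (G b - G a)) UNIV"
      using I smG[of a b] that by (intro nn_integral_has_integral) (auto simp: f_def)
    moreover have "(\<lambda>t. f t * indicator {a..b} t) = (\<lambda>t. if t \<in> {a..b} then f t else 0)"
      by (auto simp: indicator_def)
    ultimately show ?thesis using has_integral_restrict_UNIV by metis
  qed
  define y where "y t = f t - (M + 1)" for t
  show ?thesis
  proof (intro exI[of _ y] allI impI conjI)
    fix a b :: real assume "a \<le> b"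
    have "f absolutely_integrable_on {a..b}"
      by (rule nonnegative_absolutely_integrable_1) (use f[OF \<open>a \<le> b\<close>] in \<open>auto simp: f_def has_integral_integrable\<close>)
    then show "y absolutely_integrable_on {a..b}"
      unfolding y_def by (intro set_integral_diff absolutely_integrable_on_const) auto
    have "((\<lambda>t. f t - (M + 1)) has_integral ((G b - G a) - (b - a) *\<^sub>R (M + 1))) {a..b}"
      using has_integral_const_real[of "M + 1" a b] \<open>a \<le> b\<close> by (intro has_integral_diff f) auto
    then show "(y has_integral (g b - g a)) {a..b}"
      unfolding y_def by (simp add: G_def algebra_simps)
  qed
qed

text \<open>Coordinates inherit the Lipschitz constant, so scalar densities of the coordinates
  assemble into a vector-valued one.\<close>

lemma lipschitz_on_has_density:
  fixes f :: "real \<Rightarrow> 'a::euclidean_space"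
  assumes lip: "M-lipschitz_on UNIV f"
  obtains y where "\<And>a b. a \<le> b \<Longrightarrow> y absolutely_integrable_on {a..b}"
    "\<And>a b. a \<le> b \<Longrightarrow> (y has_integral (f b - f a)) {a..b}"
proof -
  have "\<exists>\<rho>. \<forall>a b. a \<le> b \<longrightarrow> \<rho> absolutely_integrable_on {a..b} \<and> (\<rho> has_integral (f b \<bullet> i - f a \<bullet> i)) {a..b}"
    if "i \<in> Basis" for i
  proof (rule lipschitz_on_real_has_density, rule lipschitz_onI)
    fix s t
    have "dist (f s \<bullet> i) (f t \<bullet> i) \<le> dist (f s) (f t)"
      using Basis_le_norm[OF that, of "f s - f t"] by (simp add: dist_norm inner_diff_left)
    also have "\<dots> \<le> M * dist s t" using lipschitz_onD[OF lip] by simp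
    finally show "dist (f s \<bullet> i) (f t \<bullet> i) \<le> M * dist s t" .
  qed (rule lipschitz_on_nonneg[OF lip])
  then obtain \<rho> where \<rho>: "\<And>i a b. i \<in> Basis \<Longrightarrow> a \<le> b \<Longrightarrow> \<rho> i absolutely_integrable_on {a..b} \<and>
      (\<rho> i has_integral (f b \<bullet> i - f a \<bullet> i)) {a..b}"
    by metis
  define y where "y t = (\<Sum>i\<in>Basis. \<rho> i t *\<^sub>R i)" for t
  show thesis
  proof (rule that[of y])
    fix a b :: real assume "a \<le> b"
    then show "y absolutely_integrable_on {a..b}"
      unfolding absolutely_integrable_componentwise_iff[where f=y]
      using \<rho> by (auto simp: y_def)
    show "(y has_integral (f b - f a)) {a..b}"
      unfolding has_integral_componentwise_iff[where f=y]
      using \<rho> \<open>a \<le> b\<close> by (auto simp: y_def inner_diff_left)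
  qed
qed

text \<open>By Vitali, a set where the difference quotients of \<open>F\<close> stay away from \<open>y\<close> is covered up to a null
  set by disjoint intervals subordinate to a Henstock gauge of \<open>y\<close>; Henstock's lemma bounds their
  total length.\<close>

lemma indefinite_integral_has_vector_derivative_AE:
  fixes F y :: "real \<Rightarrow> 'a::euclidean_space"
  assumes int: "\<And>a b. a \<le> b \<Longrightarrow> (y has_integral (F b - F a)) {a..b}"
  shows "negligible {t. \<not> (F has_vector_derivative y t) (at t)}"
proof -
  \<comment> \<open>The tag \<open>t\<close> may be any point of \<open>[u, v]\<close>, as in a
    tagged division. Differentiability at \<open>t\<close> will only need the cases
    \<open>u = t\<close> and \<open>v = t\<close>.\<close>
  define bad where "bad e t u v \<longleftrightarrow> u \<le> t \<and> t \<le> v \<and> u < v \<and>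
      e * (v - u) < norm ((v - u) *\<^sub>R y t - (F v - F u))" for e t u v
  define E where "E c e = {t \<in> {-c<..<c}. \<forall>\<delta>>0. \<exists>u v. bad e t u v \<and> v - u < \<delta>}" for c e :: real
  have negE: "negligible (E c e)" if "e > 0" "c > 0" for c e
    unfolding negligible_outer_le
  proof (intro allI impI)
    fix \<eta> :: real assume "\<eta> > 0"
    have "y integrable_on cbox (-c) c"
      using int[of "-c" c] \<open>c > 0\<close> by (auto simp: has_integral_integrable)
    \<comment> \<open>Each bad interval contributes more than \<open>e\<close> times its length to
      the Henstock sum, so the bound \<open>e * \<eta>\<close> leaves a total length of at most
      \<open>\<eta>\<close>.\<close>
    then obtain \<gamma> where "gauge \<gamma>" and \<gamma>:
      "\<And>p. \<lbrakk>p tagged_partial_division_of (cbox (-c) c); \<gamma> fine p\<rbrakk> \<Longrightarrow>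
             sum (\<lambda>(x,k). norm(measure lborel k *\<^sub>R y x - integral k y)) p < e * \<eta>"
      using mult_pos_pos[OF \<open>e > 0\<close> \<open>\<eta> > 0\<close>] by (rule Henstock_lemma) blast
    \<comment> \<open>The covering theorem speaks of balls indexed by a set. An index keeps the tag
      together with its interval; \<open>a\<close> and \<open>r\<close> turn the interval into a
      ball.\<close>
    define K where "K = {(t,u,v). bad e t u v \<and> {u..v} \<subseteq> \<gamma> t \<inter> {-c<..<c}}"
    define a where "a = (\<lambda>(t::real,u,v). (u + v) / 2 :: real)"
    define r where "r = (\<lambda>(t::real,u,v). (v - u) / 2 :: real)"
    have cb: "cball (a (t,u,v)) (r (t,u,v)) = {u..v}" for t u v
      unfolding a_def r_def by (simp add: cball_eq_atLeastAtMost field_simps)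
    have rpos: "0 < r i" if "i \<in> K" for i
      using that by (auto simp: K_def r_def bad_def)
    have vit: "\<exists>i. i \<in> K \<and> t \<in> cball (a i) (r i) \<and> r i < d" if t: "t \<in> E c e" and "0 < d" for t d
    proof -
      have "open (\<gamma> t \<inter> {-c<..<c})" "t \<in> \<gamma> t \<inter> {-c<..<c}"
        using t \<open>gauge \<gamma>\<close> by (auto simp: E_def gauge_def)
      then obtain \<delta> where "\<delta> > 0" and \<delta>: "ball t \<delta> \<subseteq> \<gamma> t \<inter> {-c<..<c}"
        by (meson openE)
      then obtain u v where uv: "bad e t u v" "v - u < min \<delta> d"
        using t \<open>0 < d\<close> unfolding E_def by (auto dest!: spec[of _ "min \<delta> d"])
      then have "{u..v} \<subseteq> ball t \<delta>"
        by (auto simp: bad_def dist_real_def)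
      then have "(t,u,v) \<in> K" using uv \<delta> by (auto simp: K_def)
      moreover have "t \<in> cball (a (t,u,v)) (r (t,u,v))"
        using uv by (simp add: cb bad_def)
      moreover have "r (t,u,v) < d"
        using uv \<open>0 < d\<close> by (auto simp: r_def bad_def)
      ultimately show ?thesis by blast
    qed
    obtain C where C: "countable C" "C \<subseteq> K"
     "pairwise (\<lambda>i j. disjnt (cball (a i) (r i)) (cball (a j) (r j))) C"
     "negligible (E c e - (\<Union>i \<in> C. cball (a i) (r i)))"
      by (rule Vitali_covering_theorem_cballs[of K r "E c e" a, OF rpos vit])
    \<comment> \<open>Finite subfamilies form a gauge-fine tagged partial division, so Henstock's
      lemma applies to them. The bound is uniform and therefore passes to the countable
      union.\<close>
    have fin: "measure lebesgue (\<Union>i\<in>C'. cball (a i) (r i)) \<le> \<eta>" if "C' \<subseteq> C" "finite C'" for C'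
    proof -
      define q where "q = (\<lambda>(t::real,u::real,v). (t, {u..v}))"
      have mem: "u \<le> t \<and> t \<le> v \<and> {u..v} \<subseteq> {-c..c} \<and> {u..v} \<subseteq> \<gamma> t \<and> u < v \<and>
          e * (v - u) < norm ((v - u) *\<^sub>R y t - (F v - F u))" if "(t,u,v) \<in> C'" for t u v
        using that \<open>C' \<subseteq> C\<close> \<open>C \<subseteq> K\<close> by (fastforce simp: K_def bad_def)
      have disj: "{u..v} \<inter> {u'..v'} = {}"
        if "(t,u,v) \<in> C'" "(t',u',v') \<in> C'" "(t,u,v) \<noteq> (t',u',v')" for t u v t' u' v'
        using pairwiseD[OF C(3), of "(t,u,v)" "(t',u',v')"] that \<open>C' \<subseteq> C\<close>
        by (simp add: cb disjnt_def subset_iff)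
      have inj: "inj_on q C'"
      proof (rule inj_onI)
        fix i j assume ij: "i \<in> C'" "j \<in> C'" "q i = q j"
        obtain t u v t' u' v' where eq: "i = (t,u,v)" "j = (t',u',v')" by (cases i, cases j)
        then have "u < v" "u' < v'" using ij mem by blast+
        then show "i = j" using ij unfolding eq by (auto simp: q_def Icc_eq_Icc)
      qed
      have p: "q ` C' tagged_partial_division_of cbox (-c) c"
        unfolding tagged_partial_division_of_def
      proof (intro conjI allI impI)
        show "finite (q ` C')" using that by simp
      next
        fix x k assume "(x,k) \<in> q ` C'"
        then show "x \<in> k" "k \<subseteq> cbox (-c) c" "\<exists>a b. k = cbox a b"
          using mem by (fastforce simp: q_def)+
      next
        fix x1 k1 x2 k2 assume *: "(x1, k1) \<in> q ` C' \<and> (x2, k2) \<in> q ` C' \<and> (x1, k1) \<noteq> (x2, k2)"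
        then obtain u1 v1 u2 v2 where "(x1,u1,v1) \<in> C'" "k1 = {u1..v1}" "(x2,u2,v2) \<in> C'" "k2 = {u2..v2}"
          by (auto simp: q_def)
        with * have "k1 \<inter> k2 = {}" using disj by blast
        then show "interior k1 \<inter> interior k2 = {}"
          using interior_subset by blast
      qed
      have "\<gamma> fine q ` C'" using mem by (fastforce simp: fine_def q_def)
      from \<gamma>[OF p this] have *: "(\<Sum>i\<in>C'. case q i of (x,k) \<Rightarrow> norm (measure lborel k *\<^sub>R y x - integral k y)) < e * \<eta>"
        by (simp add: sum.reindex[OF inj] o_def)
      have "measure lebesgue (\<Union>i\<in>C'. cball (a i) (r i)) \<le> (\<Sum>i\<in>C'. measure lebesgue (cball (a i) (r i)))"
        by (rule measure_UNION_le) (use that in auto)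
      also have "\<dots> \<le> (\<Sum>i\<in>C'. (case q i of (x,k) \<Rightarrow> norm (measure lborel k *\<^sub>R y x - integral k y)) / e)"
      proof (rule sum_mono)
        fix i assume "i \<in> C'"
        obtain t u v where i: "i = (t,u,v)" by (cases i)
        have m: "u < v" "e * (v - u) < norm ((v - u) *\<^sub>R y t - (F v - F u))"
          using mem \<open>i \<in> C'\<close> i by auto
        moreover have "integral {u..v} y = F v - F u"
          using int[of u v] m by (simp add: integral_unique)
        ultimately have "(case q i of (x,k) \<Rightarrow> norm (measure lborel k *\<^sub>R y x - integral k y))
            = norm ((v - u) *\<^sub>R y t - (F v - F u))"
          by (simp add: i q_def)
        moreover have "measure lebesgue (cball (a i) (r i)) = v - u"
          using m by (simp add: i cb)
        ultimately show "measure lebesgue (cball (a i) (r i)) \<le>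
           (case q i of (x,k) \<Rightarrow> norm (measure lborel k *\<^sub>R y x - integral k y)) / e"
          using m \<open>e > 0\<close> by (simp add: pos_le_divide_eq mult.commute less_imp_le)
      qed
      also have "\<dots> = (\<Sum>i\<in>C'. case q i of (x,k) \<Rightarrow> norm (measure lborel k *\<^sub>R y x - integral k y)) / e"
        by (simp add: sum_divide_distrib)
      also have "\<dots> \<le> \<eta>" using * \<open>e > 0\<close> by (simp add: field_simps)
      finally show ?thesis .
    qed
    let ?U = "\<Union>i\<in>C. cball (a i) (r i)" and ?N = "E c e - (\<Union>i \<in> C. cball (a i) (r i))"
    have U: "?U \<in> lmeasurable" "measure lebesgue ?U \<le> \<eta>"
      using fmeasurable_UN_bound[OF \<open>countable C\<close>, of "\<lambda>i. cball (a i) (r i)" lebesgue \<eta>]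
        measure_UN_bound[OF \<open>countable C\<close>, of "\<lambda>i. cball (a i) (r i)" lebesgue \<eta>] fin \<open>\<eta> > 0\<close>
      by auto
    have "?N \<in> lmeasurable" "measure lebesgue ?N = 0"
      using C(4) by (rule negligible_imp_measurable, rule negligible_imp_measure0)
    then have "?U \<union> ?N \<in> lmeasurable" "measure lebesgue (?U \<union> ?N) \<le> \<eta>"
      using fmeasurable.Un[OF U(1), of ?N]
        order_trans[OF measure_Un_le[OF fmeasurableD fmeasurableD] _, OF U(1), of ?N \<eta>] U(2)
      by (simp_all only: add_0_right)
    then show "\<exists>T. E c e \<subseteq> T \<and> T \<in> lmeasurable \<and> measure lebesgue T \<le> \<eta>"
      by (intro exI[of _ "?U \<union> ?N"]) blast
  qed
  \<comment> \<open>One index serves both purposes: as \<open>n\<close> grows, the window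
    \<open>(-(n+1), n+1)\<close> swallows any given \<open>t\<close> and the tolerance
    \<open>1/(n+1)\<close> falls below any given \<open>e\<close>.\<close>
  have "{t. \<not> (F has_vector_derivative y t) (at t)} \<subseteq> (\<Union>n. E (Suc n) (1 / Suc n))"
  proof (rule subsetI, rule ccontr)
    fix t assume t: "t \<in> {t. \<not> (F has_vector_derivative y t) (at t)}" and nE: "t \<notin> (\<Union>n. E (Suc n) (1 / Suc n))"
    have "(F has_vector_derivative y t) (at t)"
      unfolding has_vector_derivative_def has_derivative_at_alt
    proof (intro conjI allI impI bounded_linear_scaleR_left)
      fix e :: real assume "e > 0"
      obtain n1 :: nat where n1: "\<bar>t\<bar> < n1" using reals_Archimedean2 by blast
      obtain n2 :: nat where n2: "1 / e < n2" using reals_Archimedean2 by blast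
      define n where "n = max n1 n2"
      have "\<bar>t\<bar> < Suc n" "1 / e < Suc n"
        using n1 n2 by (auto simp: n_def)
      then have "1 / Suc n \<le> e" "0 < 1 / real (Suc n)"
        using \<open>e > 0\<close> by (auto simp: field_simps)
      have "t \<notin> E (Suc n) (1 / Suc n)" using nE by blast
      moreover have "t \<in> {- real (Suc n)<..<real (Suc n)}"
        using \<open>\<bar>t\<bar> < Suc n\<close> unfolding greaterThanLessThan_iff by linarith
      ultimately have "\<not> (\<forall>\<delta>>0. \<exists>u v. bad (1 / Suc n) t u v \<and> v - u < \<delta>)"
        unfolding E_def by blast
      then obtain \<delta> where "\<delta> > 0" and \<delta>: "\<And>u v. v - u < \<delta> \<Longrightarrow> \<not> bad (1 / Suc n) t u v" by blast
      have "norm (F s - F t - (s - t) *\<^sub>R y t) \<le> e * norm (s - t)" if s: "norm (s - t) < \<delta>" for s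
      proof -
        have "norm (F s - F t - (s - t) *\<^sub>R y t) \<le> (1 / Suc n) * norm (s - t)"
        proof (cases s t rule: linorder_cases)
          case less
          then have "norm ((t - s) *\<^sub>R y t - (F t - F s)) \<le> 1 / Suc n * (t - s)"
            using \<delta>[of t s] s unfolding bad_def by auto
          moreover have "norm ((t - s) *\<^sub>R y t - (F t - F s)) = norm (F s - F t - (s - t) *\<^sub>R y t)"
            by (simp add: algebra_simps)
          ultimately show ?thesis using less by simp
        next
          case greater
          then have "norm ((s - t) *\<^sub>R y t - (F s - F t)) \<le> 1 / Suc n * (s - t)"
            using \<delta>[of s t] s unfolding bad_def by auto
          then show ?thesis using greater by (simp add: norm_minus_commute)
        qed simp
        also have "\<dots> \<le> e * norm (s - t)"
          using \<open>1 / Suc n \<le> e\<close> by (intro mult_right_mono) auto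
        finally show ?thesis .
      qed
      then show "\<exists>d>0. \<forall>s. norm (s - t) < d \<longrightarrow> norm (F s - F t - (s - t) *\<^sub>R y t) \<le> e * norm (s - t)"
        using \<open>\<delta> > 0\<close> by blast
    qed
    then show False using t by simp
  qed
  moreover have "negligible (\<Union>n. E (Suc n) (1 / Suc n))"
    by (intro negligible_countable_Union) (auto intro!: negE)
  ultimately show ?thesis using negligible_subset by blast
qed

text \<open>The density does double duty: it witnesses absolute continuity, and it is the derivative
  outside a negligible set. The second part is Rademacher's theorem on the line.\<close>

lemma
  fixes z :: "real \<Rightarrow> 'a::euclidean_space"
  assumes "L-lipschitz_on UNIV z"
  shows lipschitz_on_imp_ac_curve: "ac_curve z"
    and lipschitz_on_imp_differentiable_AE: "negligible {t. \<not> (\<exists>w. (z has_vector_derivative w) (at t))}"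
proof -
  obtain y where y: "\<And>a b. a \<le> b \<Longrightarrow> y absolutely_integrable_on {a..b}"
    "\<And>a b. a \<le> b \<Longrightarrow> (y has_integral (z b - z a)) {a..b}"
    using lipschitz_on_has_density[OF assms] by metis
  show "ac_curve z"
    unfolding ac_curve_def
  proof (intro exI[of _ y] allI impI conjI)
    fix t :: real assume "0 \<le> t"
    then show "y absolutely_integrable_on {0..t}" by (rule y)
    show "z t = z 0 + integral {0..t} y"
      using integral_unique[OF y(2)[OF \<open>0 \<le> t\<close>]] by simp
  qed
  have "negligible {t. \<not> (z has_vector_derivative y t) (at t)}"
    by (rule indefinite_integral_has_vector_derivative_AE) (rule y)
  then show "negligible {t. \<not> (\<exists>w. (z has_vector_derivative w) (at t))}"
    by (rule negligible_subset) auto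
qed

section \<open>Compactness of time shifts\<close>

text \<open>The Arzela-Ascoli argument: a diagonal subsequence converges at all rational times, and
  the Lipschitz bound common to all shifts carries convergence over to every real time.\<close>

lemma lipschitz_shift_subsequence:
  fixes W :: "real \<Rightarrow> 'a::euclidean_space" and s :: "nat \<Rightarrow> real"
  assumes lip: "L-lipschitz_on UNIV W" and bd: "bounded (range W)"
  obtains \<rho> z where "strict_mono (\<rho> :: nat \<Rightarrow> nat)" "L-lipschitz_on UNIV z"
    "\<And>t. (\<lambda>n. W (s (\<rho> n) + t)) \<longlonglongrightarrow> z t"
proof -
  obtain B where B: "\<And>t. norm (W t) \<le> B" using bd by (auto simp: bounded_iff)
  obtain \<rho> where \<rho>: "strict_mono (\<rho> :: nat \<Rightarrow> nat)"
    and conv: "\<And>q. q \<in> \<rat> \<Longrightarrow> \<exists>l. (\<lambda>n. W (s (\<rho> n) + q)) \<longlonglongrightarrow> l"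
    by (rule function_convergent_subsequence[OF countable_rat, of "\<lambda>n t. W (s n + t)" B])
      (use B in auto)
  have L: "L \<ge> 0" using lip by (rule lipschitz_on_nonneg)
  have "\<exists>l. (\<lambda>n. W (s (\<rho> n) + t)) \<longlonglongrightarrow> l" for t
  proof -
    have "Cauchy (\<lambda>n. W (s (\<rho> n) + t))"
    proof (rule metric_CauchyI)
      fix e :: real assume "e > 0"
      \<comment> \<open>Dividing by \<open>L + 1\<close> instead of \<open>L\<close> covers the case
        \<open>L = 0\<close>.\<close>
      then have "e / (3 * (L + 1)) > 0" using L by simp
      then obtain q where q: "q \<in> \<rat>" "t < q" "q < t + e / (3 * (L + 1))"
        by (metis Rats_dense_in_real less_add_same_cancel1)
      have near: "dist (W (s (\<rho> n) + t)) (W (s (\<rho> n) + q)) < e / 3" for n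
      proof -
        have "dist (W (s (\<rho> n) + t)) (W (s (\<rho> n) + q)) \<le> L * \<bar>q - t\<bar>"
          using lipschitz_onD[OF lip, of "s (\<rho> n) + t" "s (\<rho> n) + q"] by (simp add: dist_real_def abs_minus_commute)
        also have "\<dots> \<le> (L + 1) * (q - t)" using q L by (simp add: algebra_simps)
        also have "\<dots> < e / 3" using q L by (simp add: field_simps)
        finally show ?thesis .
      qed
      have "Cauchy (\<lambda>n. W (s (\<rho> n) + q))" using conv[OF q(1)] by (metis LIMSEQ_imp_Cauchy)
      then obtain M where M: "\<And>i j. i \<ge> M \<Longrightarrow> j \<ge> M \<Longrightarrow>
          dist (W (s (\<rho> i) + q)) (W (s (\<rho> j) + q)) < e / 3"
        using \<open>e > 0\<close> metric_CauchyD[of _ "e / 3"] by fastforce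
      have "dist (W (s (\<rho> i) + t)) (W (s (\<rho> j) + t)) < e" if "i \<ge> M" "j \<ge> M" for i j
        using near[of i] near[of j] M[OF that]
          dist_triangle[of "W (s (\<rho> i) + t)" "W (s (\<rho> j) + t)" "W (s (\<rho> i) + q)"]
          dist_triangle2[of "W (s (\<rho> i) + q)" "W (s (\<rho> j) + t)" "W (s (\<rho> j) + q)"]
        by linarith
      then show "\<exists>M. \<forall>i\<ge>M. \<forall>j\<ge>M. dist (W (s (\<rho> i) + t)) (W (s (\<rho> j) + t)) < e" by blast
    qed
    then show ?thesis by (simp add: Cauchy_convergent_iff convergent_def)
  qed
  then obtain z where z: "\<And>t. (\<lambda>n. W (s (\<rho> n) + t)) \<longlonglongrightarrow> z t" by metis
  have "L-lipschitz_on UNIV z"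
  proof (rule lipschitz_onI[OF _ L])
    fix a b
    have "(\<lambda>n. dist (W (s (\<rho> n) + a)) (W (s (\<rho> n) + b))) \<longlonglongrightarrow> dist (z a) (z b)"
      by (intro tendsto_dist z)
    then show "dist (z a) (z b) \<le> L * dist a b"
    proof (rule Lim_bounded)
      show "\<forall>n\<ge>0. dist (W (s (\<rho> n) + a)) (W (s (\<rho> n) + b)) \<le> L * dist a b"
      proof (intro allI impI)
        fix n show "dist (W (s (\<rho> n) + a)) (W (s (\<rho> n) + b)) \<le> L * dist a b"
          using lipschitz_onD[OF lip, of "s (\<rho> n) + a" "s (\<rho> n) + b"] by simp
      qed
    qed
  qed
  then show thesis using that \<rho> z by blast
qed

text \<open>Serves evaluation at times that vary with \<open>n\<close>, such as hitting times: the
  Lipschitz bound does not depend on the shift.\<close>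

lemma tendsto_lipschitz_shift:
  fixes W :: "real \<Rightarrow> 'a::real_normed_vector"
  assumes lip: "L-lipschitz_on UNIV W" and lim: "(\<lambda>n. W (s n + t)) \<longlonglongrightarrow> l" and u: "u \<longlonglongrightarrow> t"
  shows "(\<lambda>n. W (s n + u n)) \<longlonglongrightarrow> l"
proof -
  have "(\<lambda>n. W (s n + u n) - W (s n + t)) \<longlonglongrightarrow> 0"
  proof (rule Lim_null_comparison)
    show "\<forall>\<^sub>F n in sequentially. norm (W (s n + u n) - W (s n + t)) \<le> L * \<bar>u n - t\<bar>"
    proof (intro always_eventually allI)
      fix n show "norm (W (s n + u n) - W (s n + t)) \<le> L * \<bar>u n - t\<bar>"
        using lipschitz_onD[OF lip, of "s n + u n" "s n + t"] by (simp add: dist_norm)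
    qed
    show "(\<lambda>n. L * \<bar>u n - t\<bar>) \<longlonglongrightarrow> 0"
      using u by (intro tendsto_mult_right_zero tendsto_rabs_zero) (simp add: LIM_zero)
  qed
  from tendsto_add[OF this lim] show ?thesis by simp
qed

section \<open>Limits of the interpolated curve\<close>

text \<open>The indices \<open>k n\<close> tend to infinity but may repeat or decrease. Thinning
  makes positions and indices strictly increasing at once: positions to keep the limit, indices to
  obtain a subsequence of \<open>x\<close>.\<close>

lemma limit_pointI_filterlim:
  fixes k :: "nat \<Rightarrow> nat"
  assumes k: "filterlim k at_top sequentially" and lim: "(\<lambda>n. x (k n)) \<longlonglongrightarrow> p"
  shows "limit_point x p"
proof -
  have "\<exists>\<rho>. \<forall>n::nat. True \<and> (\<rho> n < \<rho> (Suc n) \<and> k (\<rho> n) < k (\<rho> (Suc n)))"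
  proof (rule dependent_nat_choice)
    fix i n :: nat
    have "\<forall>\<^sub>F j in sequentially. k i < k j"
      using k unfolding filterlim_at_top by (auto simp: Suc_le_eq dest!: spec[of _ "Suc (k i)"])
    then have "\<forall>\<^sub>F j in sequentially. i < j \<and> k i < k j"
      using eventually_gt_at_top[of i] by eventually_elim auto
    then show "\<exists>j. True \<and> (i < j \<and> k i < k j)"
      by (auto simp: eventually_sequentially)
  qed simp
  then obtain \<rho> where "\<And>n. \<rho> n < \<rho> (Suc n)" "\<And>n. k (\<rho> n) < k (\<rho> (Suc n))"
    by blast
  then have "strict_mono \<rho>" "strict_mono (\<lambda>n. k (\<rho> n))"
    by (simp_all add: strict_mono_Suc_iff)
  then show ?thesis
    using LIMSEQ_subseq_LIMSEQ[OF lim, of \<rho>] unfolding limit_point_def by (auto simp: o_def)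
qed

text \<open>\<open>m t\<close> is the index of the step in progress at time \<open>t\<close>, so \<open>y (m t)\<close> is the slope of \<open>W\<close> at \<open>t\<close>.\<close>

locale interpolation =
  fixes x y :: "nat \<Rightarrow> 'a::euclidean_space" and W :: "real \<Rightarrow> 'a" and m :: "real \<Rightarrow> nat" and L :: real
  assumes lipschitz: "L-lipschitz_on UNIV W"
    and bounded_range: "bounded (range W)"
    and index_at_top: "filterlim m at_top at_top"
    and approx: "((\<lambda>t. W t - x (m t)) \<longlongrightarrow> 0) at_top"
    and increment_ge: "\<And>d c a b. 0 \<le> a \<Longrightarrow> a \<le> b \<Longrightarrow> (\<And>s. a \<le> s \<Longrightarrow> s \<le> b \<Longrightarrow> c \<le> d \<bullet> y (m s))
      \<Longrightarrow> c * (b - a) \<le> d \<bullet> (W b - W a)"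
begin

lemma limit_point_shift:
  assumes "filterlim s at_top sequentially" "(\<lambda>n. W (s n)) \<longlonglongrightarrow> p"
  shows "limit_point x p"
proof (rule limit_pointI_filterlim)
  show "filterlim (\<lambda>n. m (s n)) at_top sequentially"
    using filterlim_compose[OF index_at_top assms(1)] .
  have "(\<lambda>n. W (s n) - x (m (s n))) \<longlonglongrightarrow> 0"
    using filterlim_compose[OF approx assms(1)] .
  from tendsto_diff[OF assms(2) this] show "(\<lambda>n. x (m (s n))) \<longlonglongrightarrow> p" by simp
qed

text \<open>If the \<open>y k\<close> with \<open>x k\<close> near \<open>z t\<close> all had a larger component along \<open>d\<close> than \<open>w\<close>, then so
  would the slopes of \<open>z\<close> to the right of \<open>t\<close>.\<close>

lemma shift_limit_derivative:
  assumes s: "filterlim s at_top sequentially"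
    and lim: "\<And>t. (\<lambda>n. W (s n + t)) \<longlonglongrightarrow> z t"
    and der: "(z has_vector_derivative w) (at t)"
    and "e > 0"
  shows "\<exists>k>N. dist (x k) (z t) < e \<and> d \<bullet> (y k - w) \<le> e"
proof (rule ccontr)
  assume "\<not> ?thesis"
  then have far: "d \<bullet> w + e \<le> d \<bullet> y k" if "k > N" "dist (x k) (z t) < e" for k
    using that by (force simp: inner_diff_right not_le algebra_simps)
  have L: "L \<ge> 0" using lipschitz by (rule lipschitz_on_nonneg)
  \<comment> \<open>Within a time \<open>h0\<close> the curve moves less than \<open>e / 3\<close>.
    The other two thirds pay for the distance from \<open>x (m u)\<close> to \<open>W u\<close> and
    for that from \<open>W (s n + t)\<close> to \<open>z t\<close>.\<close>
  define h0 where "h0 = e / (3 * (L + 1))"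
  have "h0 > 0" using \<open>e > 0\<close> L by (simp add: h0_def)
  have slope: "(d \<bullet> w + e) * h \<le> d \<bullet> (z (t + h) - z t)" if h: "0 < h" "h < h0" for h
  proof (rule tendsto_lowerbound)
    show "(\<lambda>n. d \<bullet> (W (s n + (t + h)) - W (s n + t))) \<longlonglongrightarrow> d \<bullet> (z (t + h) - z t)"
      by (intro tendsto_intros lim)
    have "\<forall>\<^sub>F u in at_top. N < m u \<and> norm (W u - x (m u)) < e / 3"
    proof (rule eventually_conj)
      show "\<forall>\<^sub>F u in at_top. N < m u"
        using index_at_top unfolding filterlim_at_top by (auto simp: Suc_le_eq dest!: spec[of _ "Suc N"])
      show "\<forall>\<^sub>F u in at_top. norm (W u - x (m u)) < e / 3"
        using tendstoD[OF approx, of "e / 3"] \<open>e > 0\<close> by (simp add: dist_norm)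
    qed
    then obtain R where R: "\<And>u. u \<ge> R \<Longrightarrow> N < m u \<and> norm (W u - x (m u)) < e / 3"
      by (auto simp: eventually_at_top_linorder)
    \<comment> \<open>The \<open>0\<close> in the maximum is there for \<open>increment_ge\<close>,
      which requires a nonnegative left endpoint.\<close>
    have "\<forall>\<^sub>F n in sequentially. s n \<ge> max R 0 - t"
      using s by (simp add: filterlim_at_top)
    moreover have "\<forall>\<^sub>F n in sequentially. dist (W (s n + t)) (z t) < e / 3"
      using tendstoD[OF lim[of t], of "e / 3"] \<open>e > 0\<close> by simp
    ultimately show "\<forall>\<^sub>F n in sequentially. (d \<bullet> w + e) * h \<le> d \<bullet> (W (s n + (t + h)) - W (s n + t))"
    proof eventually_elim
      case (elim n)
      have "(d \<bullet> w + e) * ((s n + (t + h)) - (s n + t)) \<le> d \<bullet> (W (s n + (t + h)) - W (s n + t))"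
      proof (rule increment_ge)
        fix u assume u: "s n + t \<le> u" "u \<le> s n + (t + h)"
        have "dist (W u) (W (s n + t)) \<le> L * (u - (s n + t))"
          using lipschitz_onD[OF lipschitz, of u "s n + t"] u by (simp add: dist_real_def)
        also have "\<dots> \<le> (L + 1) * h" using u L by (intro mult_mono) auto
        also have "\<dots> < e / 3" using h L by (simp add: h0_def field_simps)
        finally have "dist (W u) (W (s n + t)) < e / 3" .
        moreover have "N < m u" "dist (x (m u)) (W u) < e / 3"
          using R[of u] u elim by (auto simp: dist_norm norm_minus_commute)
        ultimately have "dist (x (m u)) (z t) < e"
          using elim(2) dist_triangle[of "x (m u)" "z t" "W u"] dist_triangle[of "W u" "z t" "W (s n + t)"]
          by linarith
        then show "d \<bullet> w + e \<le> d \<bullet> y (m u)" using far \<open>N < m u\<close> by blast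
      qed (use h elim in auto)
      then show ?case by simp
    qed
  qed simp
  have "((\<lambda>t. d \<bullet> z t) has_real_derivative d \<bullet> w) (at t)"
    using bounded_linear.has_vector_derivative[OF bounded_linear_inner_right der]
    by (simp add: has_real_derivative_iff_has_vector_derivative)
  then have "((\<lambda>h. (d \<bullet> z (t + h) - d \<bullet> z t) / h) \<longlongrightarrow> d \<bullet> w) (at_right 0)"
    unfolding DERIV_def by (rule filterlim_mono[OF _ order_refl at_le]) simp
  moreover have "\<forall>\<^sub>F h in at_right 0. d \<bullet> w + e \<le> (d \<bullet> z (t + h) - d \<bullet> z t) / h"
    using eventually_at_right_real[OF \<open>h0 > 0\<close>]
    by eventually_elim (use slope in \<open>auto simp: pos_le_divide_eq inner_diff_right\<close>)
  ultimately have "d \<bullet> w + e \<le> d \<bullet> w" by (rule tendsto_lowerbound) simp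
  then show False using \<open>e > 0\<close> by simp
qed

end

text \<open>Assumption \<open>G\<close> is the form in which the averaging hypothesis enters. Every
  derivative of \<open>z\<close> meets its premise, so the inclusion can fail only where
  \<open>z\<close> is not differentiable.\<close>

lemma (in interpolation) shift_limit_trajectory:
  assumes s: "filterlim s at_top sequentially"
    and lim: "\<And>t. (\<lambda>n. W (s n + t)) \<longlonglongrightarrow> z t"
    and lip: "L-lipschitz_on UNIV z"
    and X: "\<And>p. limit_point x p \<Longrightarrow> p \<in> X"
    and G: "\<And>p w. (\<And>d e N. e > 0 \<Longrightarrow> \<exists>k>N. dist (x k) p < e \<and> d \<bullet> (y k - w) \<le> e) \<Longrightarrow> w \<in> G p"
  shows "trajectory X G z"
  unfolding trajectory_def
proof (intro conjI allI impI)
  show "ac_curve z" using lip by (rule lipschitz_on_imp_ac_curve)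
  show "z t \<in> X" for t
  proof (intro X limit_point_shift)
    show "filterlim (\<lambda>n. s n + t) at_top sequentially"
      using filterlim_tendsto_add_at_top[OF tendsto_const s, of t] by (simp add: add.commute)
  qed (rule lim)
  show "AE t in lebesgue. 0 \<le> t \<longrightarrow> (\<exists>v\<in>G (z t). (z has_vector_derivative v) (at t))"
  proof (rule AE_I')
    show "{t. \<not> (\<exists>w. (z has_vector_derivative w) (at t))} \<in> null_sets lebesgue"
      using lipschitz_on_imp_differentiable_AE[OF lip] by (simp add: negligible_iff_null_sets)
    have "w \<in> G (z t)" if "(z has_vector_derivative w) (at t)" for t w
      using shift_limit_derivative[OF s lim that] by (rule G)
    then show "{t \<in> space lebesgue. \<not> (0 \<le> t \<longrightarrow> (\<exists>v\<in>G (z t). (z has_vector_derivative v) (at t)))}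
        \<subseteq> {t. \<not> (\<exists>w. (z has_vector_derivative w) (at t))}"
      by blast
  qed
qed

section \<open>Construction of the interpolated curve\<close>

text \<open>Adding the noise tail \<open>v - N k\<close> makes the corrected iterates
  \<open>u k\<close> move by exactly \<open>\<alpha> k *\<^sub>R y k\<close>. The polygon through
  them has slopes \<open>y k\<close>, while the correction vanishes in the limit.\<close>

lemma interpolation_exists:
  fixes x y \<xi> :: "nat \<Rightarrow> 'a::euclidean_space"
  assumes pos: "\<And>k. k \<ge> 1 \<Longrightarrow> \<alpha> k > 0"
    and rec: "\<And>k. k \<ge> 1 \<Longrightarrow> x (Suc k) = x k + \<alpha> k *\<^sub>R (y k + \<xi> k)"
    and bdx: "bounded (x ` {1..})" and bdy: "bounded (y ` {1..})"
    and div: "filterlim (\<lambda>n. \<Sum>k=1..n. \<alpha> k) at_top sequentially"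
    and null: "\<alpha> \<longlonglongrightarrow> 0"
    and noise: "(\<lambda>n. \<Sum>k=1..n. \<alpha> k *\<^sub>R \<xi> k) \<longlonglongrightarrow> v"
  obtains W m L \<tau> where "interpolation x y W m L" "filterlim \<tau> at_top sequentially"
    "\<And>k. k \<ge> 1 \<Longrightarrow> m (\<tau> k) = k"
proof -
  define \<tau> where "\<tau> k = (\<Sum>i=1..<k. \<alpha> i)" for k :: nat
  define N where "N k = (\<Sum>i=1..<k. \<alpha> i *\<^sub>R \<xi> i)" for k :: nat
  define u where "u k = x k + v - N k" for k
  have \<tau>_Suc: "\<tau> (Suc k) = \<tau> k + \<alpha> k" if "k \<ge> 1" for k using that by (simp add: \<tau>_def)
  have \<tau>1: "\<tau> 1 = 0" by (simp add: \<tau>_def)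
  have u_Suc: "u (Suc k) = u k + \<alpha> k *\<^sub>R y k" if "k \<ge> 1" for k
    using that by (simp add: u_def N_def rec algebra_simps)
  \<comment> \<open>The sums in \<open>\<tau> k\<close> and \<open>N k\<close> stop at
    \<open>k - 1\<close>, those of the hypotheses at \<open>n\<close>; hence the shift of the index
    by one.\<close>
  have \<tau>_top: "filterlim \<tau> at_top sequentially"
    using div by (subst filterlim_sequentially_Suc[symmetric]) (simp add: \<tau>_def atLeastLessThanSuc_atLeastAtMost)
  have N_lim: "N \<longlonglongrightarrow> v"
    using noise by (subst filterlim_sequentially_Suc[symmetric]) (simp add: N_def atLeastLessThanSuc_atLeastAtMost)
  have \<tau>_mono: "\<tau> j \<le> \<tau> k" if "1 \<le> j" "j \<le> k" for j k
    using that(2)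
  proof (induction k rule: dec_induct)
    case (step n)
    then show ?case using \<tau>_Suc[of n] pos[of n] \<open>1 \<le> j\<close> by simp
  qed simp
  define m where "m t = (LEAST k. 1 \<le> k \<and> t < \<tau> (Suc k))" for t
  have ex: "\<exists>k. 1 \<le> k \<and> t < \<tau> (Suc k)" for t
  proof -
    have "\<forall>\<^sub>F k in sequentially. t < \<tau> (Suc k)"
      using \<tau>_top[folded filterlim_sequentially_Suc[of \<tau>]] unfolding filterlim_at_top_dense by blast
    then show ?thesis using eventually_ge_at_top[of 1]
      by (metis (mono_tags, lifting) eventually_conj eventually_happens trivial_limit_sequentially)
  qed
  have m1: "1 \<le> m t" and m2: "t < \<tau> (Suc (m t))" for t
    using LeastI_ex[OF ex[of t]] by (auto simp: m_def)
  have m3: "\<tau> (m t) \<le> t" if "0 \<le> t" for t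
  proof (cases "m t = 1")
    case True then show ?thesis using that \<tau>1 by simp
  next
    case False
    then have "1 \<le> m t - 1" "m t - 1 < m t" using m1[of t] by auto
    then have "\<not> t < \<tau> (Suc (m t - 1))" using not_less_Least[of "m t - 1"] unfolding m_def by blast
    then show ?thesis using m1[of t] by simp
  qed
  have m_eq: "m t = k" if "1 \<le> k" "\<tau> k \<le> t" "t < \<tau> (Suc k)" for t k
    unfolding m_def
  proof (rule Least_equality)
    fix j assume "1 \<le> j \<and> t < \<tau> (Suc j)"
    then show "k \<le> j" using \<tau>_mono[of "Suc j" k] that by (meson leD le_less_trans not_less_eq_eq le_Suc_eq)
  qed (use that in auto)
  have m_\<tau>: "m (\<tau> k) = k" if "k \<ge> 1" for k
    using that pos \<tau>_Suc by (intro m_eq) auto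
  have m_top: "filterlim m at_top at_top"
    unfolding filterlim_at_top
  proof
    fix K
    show "\<forall>\<^sub>F t in at_top. K \<le> m t"
      using eventually_ge_at_top[of "\<tau> (Suc K)"]
    proof eventually_elim
      case (elim t)
      then show ?case using \<tau>_mono[of "Suc (m t)" "Suc K"] m2[of t] by force
    qed
  qed
  define U where "U t = u (m t) + (t - \<tau> (m t)) *\<^sub>R y (m t)" for t
  \<comment> \<open>\<open>U\<close> alone would continue its first segment to negative times and
    could be unbounded there; freezing it at time 0 keeps the curve bounded on the whole
    line.\<close>
  define W where "W t = U (max 0 t)" for t
  \<comment> \<open>An integral inequality for a piecewise constant slope, by induction on the
    number of nodes between \<open>a\<close> and \<open>b\<close>: the piece up to the first node
    after \<open>a\<close> is split off.\<close>
  have incr: "c * (b - a) \<le> d \<bullet> (U b - U a)"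
    if "0 \<le> a" "a \<le> b" "\<And>s. a \<le> s \<Longrightarrow> s \<le> b \<Longrightarrow> c \<le> d \<bullet> y (m s)" for a b c d
    using that
  proof (induction "m b - m a" arbitrary: a rule: less_induct)
    case less
    let ?k = "m a"
    show ?case
    proof (cases "b < \<tau> (Suc ?k)")
      case True
      then have "m b = ?k" using m_eq[of ?k b] m1 m3[of a] less.prems by simp
      then have "U b - U a = (b - a) *\<^sub>R y ?k" by (simp add: U_def algebra_simps)
      then show ?thesis using less.prems(2) mult_right_mono[OF less.prems(3)[of a], of "b - a"]
        by (simp add: mult.commute)
    next
      case False
      define s where "s = \<tau> (Suc ?k)"
      have s: "a < s" "s \<le> b" using False m2[of a] by (auto simp: s_def)
      have ms: "m s = Suc ?k" unfolding s_def by (rule m_\<tau>) simp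
      \<comment> \<open>Subtraction on naturals is truncated, so the induction measure drops only
        because \<open>m a < m b\<close>.\<close>
      have "Suc ?k \<le> m b"
      proof (rule ccontr)
        assume "\<not> ?thesis"
        then have "\<tau> (Suc (m b)) \<le> s" unfolding s_def using m1[of b] by (intro \<tau>_mono) auto
        then show False using m2[of b] s by simp
      qed
      then have "c * (b - s) \<le> d \<bullet> (U b - U s)"
        using less.prems s ms by (intro less.hyps) auto
      moreover have "U s - U a = (s - a) *\<^sub>R y ?k"
        unfolding U_def ms using u_Suc[OF m1] \<tau>_Suc[OF m1[of a]] by (simp add: s_def algebra_simps)
      then have "c * (s - a) \<le> d \<bullet> (U s - U a)"
        using s mult_right_mono[OF less.prems(3)[of a], of "s - a"] by (simp add: mult.commute)
      ultimately show ?thesis by (simp add: algebra_simps)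
    qed
  qed
  obtain B where "B > 0" and B: "\<And>k. k \<ge> 1 \<Longrightarrow> norm (y k) \<le> B"
    using bdy by (auto simp: bounded_pos)
  obtain D where D: "\<And>k. k \<ge> 1 \<Longrightarrow> norm (x k) \<le> D"
    using bdx by (auto simp: bounded_iff)
  have lipU: "norm (U b - U a) \<le> B * (b - a)" if "0 \<le> a" "a \<le> b" for a b
  proof -
    \<comment> \<open>Testing the increment against its own negative turns the one-sided bound into
      a bound on its norm.\<close>
    define d where "d = - (U b - U a)"
    have "- (norm d * B) * (b - a) \<le> d \<bullet> (U b - U a)"
    proof (rule incr[OF that])
      fix s
      have "\<bar>d \<bullet> y (m s)\<bar> \<le> norm d * norm (y (m s))" by (rule Cauchy_Schwarz_ineq2)
      also have "\<dots> \<le> norm d * B" by (intro mult_left_mono B m1) auto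
      finally show "- (norm d * B) \<le> d \<bullet> y (m s)" by linarith
    qed
    moreover have "d \<bullet> (U b - U a) = - (norm d * norm d)"
      unfolding power2_eq_square[symmetric] power2_norm_eq_inner d_def
      by (simp only: inner_minus_right inner_minus_left minus_minus)
    ultimately have "norm d * norm d \<le> norm d * (B * (b - a))" by simp
    then have "norm d \<le> B * (b - a)"
      using that \<open>B > 0\<close> by (cases "d = 0") auto
    then show ?thesis by (simp add: d_def norm_minus_commute)
  qed
  have lip: "B-lipschitz_on UNIV W"
  proof (rule lipschitz_onI)
    have *: "dist (W a) (W b) \<le> B * dist a b" if "a \<le> b" for a b
    proof -
      have "dist (W a) (W b) \<le> B * (max 0 b - max 0 a)"
        using lipU[of "max 0 a" "max 0 b"] that by (simp add: W_def dist_norm norm_minus_commute)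
      also have "\<dots> \<le> B * dist a b"
        using that \<open>B > 0\<close> by (intro mult_left_mono) (auto simp: dist_real_def)
      finally show ?thesis .
    qed
    show "dist (W a) (W b) \<le> B * dist a b" for a b
      using *[of a b] *[of b a] by (cases "a \<le> b") (auto simp: dist_commute)
  qed (use \<open>B > 0\<close> in simp)
  \<comment> \<open>The two errors are the remaining noise tail and the motion within the step in
    progress.\<close>
  have Wx: "norm (W t - x (m (max 0 t))) \<le> norm (v - N (m (max 0 t))) + \<bar>\<alpha> (m (max 0 t))\<bar> * B" for t
  proof -
    define t' where "t' = max 0 t"
    have "W t - x (m t') = (v - N (m t')) + (t' - \<tau> (m t')) *\<^sub>R y (m t')"
      by (simp add: W_def U_def u_def t'_def)
    also have "norm \<dots> \<le> norm (v - N (m t')) + \<bar>t' - \<tau> (m t')\<bar> * norm (y (m t'))"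
      by (metis norm_scaleR norm_triangle_ineq)
    also have "\<dots> \<le> norm (v - N (m t')) + \<bar>\<alpha> (m t')\<bar> * B"
    proof (intro add_left_mono mult_mono B m1)
      have "\<tau> (m t') \<le> t'" "t' < \<tau> (m t') + \<alpha> (m t')"
        using m3[of t'] m2[of t'] \<tau>_Suc[OF m1[of t']] by (auto simp: t'_def)
      then show "\<bar>t' - \<tau> (m t')\<bar> \<le> \<bar>\<alpha> (m t')\<bar>" by linarith
    qed auto
    finally show ?thesis by (simp add: t'_def)
  qed
  have err: "(\<lambda>k. norm (v - N k) + \<bar>\<alpha> k\<bar> * B) \<longlonglongrightarrow> 0"
    using tendsto_add[OF tendsto_norm_zero[OF LIM_zero[OF N_lim]] tendsto_mult_left_zero[OF tendsto_rabs_zero[OF null], of B]]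
    by (simp add: norm_minus_commute)
  have approx: "((\<lambda>t. W t - x (m t)) \<longlongrightarrow> 0) at_top"
  proof (rule Lim_null_comparison)
    show "((\<lambda>t. norm (v - N (m t)) + \<bar>\<alpha> (m t)\<bar> * B) \<longlongrightarrow> 0) at_top"
      using filterlim_compose[OF err m_top] .
    show "\<forall>\<^sub>F t in at_top. norm (W t - x (m t)) \<le> norm (v - N (m t)) + \<bar>\<alpha> (m t)\<bar> * B"
      using eventually_ge_at_top[of 0]
    proof eventually_elim
      case (elim t) then show ?case using Wx[of t] by (simp add: max_def)
    qed
  qed
  obtain H where H: "\<And>k. norm (v - N k) + \<bar>\<alpha> k\<bar> * B \<le> H"
    using convergent_imp_Bseq[OF convergentI[OF err]] unfolding Bseq_def by (auto dest: abs_le_D1)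
  have "norm (W t) \<le> D + H" for t
    using Wx[of t] H[of "m (max 0 t)"] D[OF m1[of "max 0 t"]] norm_triangle_sub[of "W t" "x (m (max 0 t))"]
    by linarith
  then have "bounded (range W)" by (auto simp: bounded_iff)
  moreover have "c * (b - a) \<le> d \<bullet> (W b - W a)"
    if "0 \<le> a" "a \<le> b" "\<And>s. a \<le> s \<Longrightarrow> s \<le> b \<Longrightarrow> c \<le> d \<bullet> y (m s)" for a b c d
    using incr[OF that] that by (simp add: W_def max_def)
  ultimately have "interpolation x y W m B"
    using lip m_top approx by unfold_locales auto
  then show thesis using that \<tau>_top m_\<tau> by blast
qed

section \<open>The Lyapunov function\<close>

text \<open>Let \<open>l\<close> be a cluster value. Some \<open>e\<close> exists such that
  \<open>f\<close> comes within \<open>e / 2\<close> of \<open>l\<close> and also leaves the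
  \<open>e\<close>-ball about \<open>l\<close> arbitrarily late. If it leaves upwards arbitrarily
  late, the levels lie above \<open>l\<close>; otherwise it eventually leaves only downwards and
  they lie below.\<close>

lemma oscillation_if_no_limit:
  fixes f :: "real \<Rightarrow> real"
  assumes bd: "bounded (range f)" and nolim: "\<And>l. \<not> (f \<longlongrightarrow> l) at_top"
  obtains a b where "a < b" "\<And>T. \<exists>t\<ge>T. f t \<le> a" "\<And>T. \<exists>t\<ge>T. b \<le> f t"
proof -
  have "bounded (range (\<lambda>n. f (real n)))" using bd by (rule bounded_subset) auto
  then obtain l r where "strict_mono r" and l: "(\<lambda>n. f (real (r n))) \<longlonglongrightarrow> l"
    using bounded_imp_convergent_subsequence[of "\<lambda>n. f (real n)"] by (auto simp: o_def)
  have top: "filterlim (\<lambda>n. real (r n)) at_top sequentially"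
    using filterlim_compose[OF filterlim_real_sequentially filterlim_subseq[OF \<open>strict_mono r\<close>]] .
  obtain e where "e > 0" and e: "\<not> (\<forall>\<^sub>F t in at_top. dist (f t) l < e)"
    using nolim[of l] by (auto simp: tendsto_iff)
  have near: "\<exists>t\<ge>T. dist (f t) l < e / 2" for T
  proof -
    have "\<forall>\<^sub>F n in sequentially. T \<le> real (r n)" using top by (simp add: filterlim_at_top)
    moreover have "\<forall>\<^sub>F n in sequentially. dist (f (real (r n))) l < e / 2"
      using tendstoD[OF l, of "e / 2"] \<open>e > 0\<close> by simp
    ultimately have "\<forall>\<^sub>F n in sequentially. T \<le> real (r n) \<and> dist (f (real (r n))) l < e / 2"
      by (rule eventually_conj)
    then show ?thesis using eventually_happens[of _ sequentially] by auto
  qed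
  have far: "\<exists>t\<ge>T. e \<le> dist (f t) l" for T
    using e by (auto simp: eventually_at_top_linorder not_less)
  show thesis
  proof (cases "\<forall>T. \<exists>t\<ge>T. l + e \<le> f t")
    case True
    show thesis
    proof (rule that[of "l + e / 2" "l + e"])
      show "\<exists>t\<ge>T. f t \<le> l + e / 2" for T
      proof -
        obtain t where "t \<ge> T" "dist (f t) l < e / 2" using near by blast
        then show ?thesis unfolding dist_real_def by (intro exI[of _ t] conjI) linarith+
      qed
    qed (use True \<open>e > 0\<close> in auto)
  next
    case False
    then obtain T0 where T0: "\<And>t. t \<ge> T0 \<Longrightarrow> f t < l + e" by (meson not_le)
    show thesis
    proof (rule that[of "l - e" "l - e / 2"])
      show "\<exists>t\<ge>T. l - e / 2 \<le> f t" for T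
      proof -
        obtain t where "t \<ge> T" "dist (f t) l < e / 2" using near by blast
        then show ?thesis unfolding dist_real_def by (intro exI[of _ t] conjI) linarith+
      qed
      show "\<exists>t\<ge>T. f t \<le> l - e" for T
      proof -
        obtain t where "t \<ge> max T T0" "e \<le> dist (f t) l" using far by blast
        then show ?thesis using T0[of t] by (intro exI[of _ t]) (auto simp: dist_real_def)
      qed
    qed (use \<open>e > 0\<close> in auto)
  qed
qed

text \<open>The time \<open>s\<close> is the maximum of the compact set where \<open>f\<close> is at
  most \<open>a\<close>; the intermediate value theorem then excludes
  \<open>f s < a\<close>.\<close>

lemma last_crossing:
  fixes f :: "real \<Rightarrow> real"
  assumes cont: "continuous_on {p..q} f" and "p \<le> q" "f p \<le> a" "a < f q"
  obtains s where "p \<le> s" "s < q" "f s = a" "\<And>u. s < u \<Longrightarrow> u \<le> q \<Longrightarrow> a < f u"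
proof -
  let ?S = "{u \<in> {p..q}. f u \<le> a}"
  have "compact ?S"
    unfolding compact_eq_bounded_closed
  proof
    show "bounded ?S" by (rule bounded_subset[OF bounded_closed_interval[of p q]]) auto
    have "?S = {p..q} \<inter> f -` {..a}" by auto
    then show "closed ?S"
      using continuous_closed_preimage[OF cont closed_atLeastAtMost closed_atMost[of a]] by simp
  qed
  moreover have "p \<in> ?S" using assms by auto
  ultimately obtain s where s: "s \<in> ?S" "\<And>u. u \<in> ?S \<Longrightarrow> u \<le> s"
    using compact_attains_sup[of ?S] by blast
  have above: "a < f u" if "s < u" "u \<le> q" for u
    using s(1) s(2)[of u] that by force
  have "s < q" using s(1) \<open>a < f q\<close> by (cases "s = q") auto
  have "continuous_on {s..q} f" using cont by (rule continuous_on_subset) (use s in auto)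
  then obtain u where "s \<le> u" "u \<le> q" "f u = a"
    using IVT'[of f s a q] s(1) \<open>a < f q\<close> \<open>s < q\<close> by auto
  then have "f s = a" using above[of u] by (cases "u = s") auto
  then show thesis using that[of s] s(1) \<open>s < q\<close> above by auto
qed

text \<open>Upward crossings of a regular level \<open>a\<close> are followed, in the limit, by a
  trajectory starting at that level. Descent pushes it strictly below \<open>a\<close> at some time
  \<open>T\<close>, although the crossing curves are still above \<open>a\<close> then.\<close>

lemma (in interpolation) lyapunov_converges:
  assumes X: "\<And>p. limit_point x p \<Longrightarrow> p \<in> X"
    and G: "\<And>p w. (\<And>d e N. e > 0 \<Longrightarrow> \<exists>k>N. dist (x k) p < e \<and> d \<bullet> (y k - w) \<le> e) \<Longrightarrow> w \<in> G p"
    and cont: "continuous_on UNIV \<phi>"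
    and sard: "closure {s::real. \<phi> -` {s} \<inter> setval_inverse X G 0 = {}} = UNIV"
    and descent: "\<And>z. trajectory X G z \<Longrightarrow> 0 \<notin> G (z 0) \<Longrightarrow>
           \<exists>T>0. \<phi> (z T) < (SUP t\<in>{0..T}. \<phi> (z t)) \<and> (SUP t\<in>{0..T}. \<phi> (z t)) \<le> \<phi> (z 0)"
  shows "\<exists>c. ((\<lambda>t. \<phi> (W t)) \<longlongrightarrow> c) at_top"
proof (rule ccontr)
  assume nolim: "\<not> ?thesis"
  define f where "f t = \<phi> (W t)" for t
  have contW: "continuous_on A W" for A
    using continuous_on_subset[OF lipschitz_on_continuous_on[OF lipschitz]] by blast
  have contf: "continuous_on A f" for A
    unfolding f_def by (rule continuous_on_compose2[OF cont contW]) auto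
  have \<phi>_lim: "(\<lambda>n. \<phi> (u n)) \<longlonglongrightarrow> \<phi> l" if "u \<longlonglongrightarrow> l" for u l
    using continuous_on_tendsto_compose[OF cont that] by simp
  have "compact (\<phi> ` closure (range W))"
    using bounded_range by (intro compact_continuous_image continuous_on_subset[OF cont]) auto
  then have "bounded (range f)"
    by (rule bounded_subset[OF compact_imp_bounded]) (use closure_subset[of "range W"] in \<open>auto simp: f_def\<close>)
  then obtain a0 b where "a0 < b" and low: "\<And>T. \<exists>t\<ge>T. f t \<le> a0" and high: "\<And>T. \<exists>t\<ge>T. b \<le> f t"
    using oscillation_if_no_limit[of f] nolim unfolding f_def by metis
  \<comment> \<open>Density of the regular levels gives one closer to the midpoint than half the
    gap, hence strictly between \<open>a0\<close> and \<open>b\<close>.\<close>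
  have "(a0 + b) / 2 \<in> closure {s. \<phi> -` {s} \<inter> setval_inverse X G 0 = {}}" using sard by simp
  then obtain a where crit: "\<phi> -` {a} \<inter> setval_inverse X G 0 = {}" and "dist a ((a0 + b) / 2) < (b - a0) / 2"
    unfolding closure_approachable using \<open>a0 < b\<close> by (auto dest!: spec[of _ "(b - a0) / 2"])
  then have "a0 < a" "a < b" by (simp_all add: dist_real_def abs_less_iff field_simps)
  have "\<exists>s q. real n \<le> s \<and> s < q \<and> f s = a \<and> b \<le> f q \<and> (\<forall>u. s < u \<and> u \<le> q \<longrightarrow> a < f u)" for n :: nat
  proof -
    obtain p where p: "real n \<le> p" "f p \<le> a0" using low by blast
    obtain q where q: "p \<le> q" "b \<le> f q" using high by blast
    obtain s where "p \<le> s" "s < q" "f s = a" "\<And>u. s < u \<Longrightarrow> u \<le> q \<Longrightarrow> a < f u"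
      using last_crossing[OF contf, of p q a] p q \<open>a0 < a\<close> \<open>a < b\<close> by auto
    then show ?thesis using p q by (intro exI[of _ s] exI[of _ q]) auto
  qed
  then obtain s q where s: "\<And>n. real n \<le> s n" and sq: "\<And>n. s n < q n" and fs: "\<And>n. f (s n) = a"
    and fq: "\<And>n. b \<le> f (q n)" and above: "\<And>n u. s n < u \<Longrightarrow> u \<le> q n \<Longrightarrow> a < f u"
    by metis
  have s_top: "filterlim s at_top sequentially"
    by (rule filterlim_at_top_mono[OF filterlim_real_sequentially]) (simp add: s)
  obtain \<rho> z where \<rho>: "strict_mono (\<rho> :: nat \<Rightarrow> nat)" and lipz: "L-lipschitz_on UNIV z"
    and lim: "\<And>t. (\<lambda>n. W (s (\<rho> n) + t)) \<longlonglongrightarrow> z t"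
    using lipschitz_shift_subsequence[OF lipschitz bounded_range, of s] by metis
  have "filterlim (\<lambda>n. s (\<rho> n)) at_top sequentially"
    using filterlim_compose[OF s_top filterlim_subseq[OF \<rho>]] .
  from shift_limit_trajectory[OF this lim lipz X G]
  have traj: "trajectory X G z" .
  have f_lim: "(\<lambda>n. f (s (\<rho> n) + t)) \<longlonglongrightarrow> \<phi> (z t)" for t
    unfolding f_def by (intro \<phi>_lim lim)
  have z0: "\<phi> (z 0) = a"
    using f_lim[of 0] by (simp add: fs LIMSEQ_const_iff)
  have "z 0 \<in> X" using traj by (simp add: trajectory_def)
  then have "0 \<notin> G (z 0)" using crit z0 by (auto simp: setval_inverse_def)
  then obtain T where "T > 0" and T: "\<phi> (z T) < (SUP t\<in>{0..T}. \<phi> (z t))" "(SUP t\<in>{0..T}. \<phi> (z t)) \<le> a"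
    using descent[OF traj] z0 by auto
  have "continuous_on {0..T} (\<lambda>t. \<phi> (z t))"
    using lipschitz_on_continuous_on[OF lipz] continuous_on_subset
    by (intro continuous_on_compose2[OF cont]) auto
  then have bdd: "bdd_above ((\<lambda>t. \<phi> (z t)) ` {0..T})"
    by (intro bounded_imp_bdd_above compact_imp_bounded compact_continuous_image) auto
  have below: "\<phi> (z t) \<le> a" if "t \<in> {0..T}" for t
    using cSUP_upper[OF that bdd] T(2) by linarith
  \<comment> \<open>Otherwise the delays from level \<open>a\<close> to \<open>b\<close> stay in
    \<open>[0, T]\<close> along a subsequence and accumulate at some \<open>t\<close>. There
    \<open>\<phi> (z t)\<close> is at least \<open>b\<close>, against the bound \<open>a\<close> on
    \<open>[0, T]\<close>.\<close>
  have "\<forall>\<^sub>F n in sequentially. s (\<rho> n) + T < q (\<rho> n)"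
  proof (rule ccontr)
    assume "\<not> ?thesis"
    from not_eventually_sequentiallyD[OF this]
    obtain \<sigma> where \<sigma>: "strict_mono (\<sigma> :: nat \<Rightarrow> nat)" "\<And>n. q (\<rho> (\<sigma> n)) \<le> s (\<rho> (\<sigma> n)) + T"
      by (auto simp: not_less)
    define \<delta> where "\<delta> n = q (\<rho> (\<sigma> n)) - s (\<rho> (\<sigma> n))" for n
    have "\<delta> n \<in> {0..T}" for n
      using \<sigma>(2)[of n] sq[of "\<rho> (\<sigma> n)"] by (simp add: \<delta>_def)
    then have "\<exists>t\<in>{0..T}. \<exists>\<kappa>. strict_mono \<kappa> \<and> (\<delta> \<circ> \<kappa>) \<longlonglongrightarrow> t"
      using compact_Icc[of 0 T] unfolding compact_def by blast
    then obtain t \<kappa> where t: "t \<in> {0..T}" and \<kappa>: "strict_mono (\<kappa> :: nat \<Rightarrow> nat)"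
      and t_lim: "(\<lambda>n. q (\<rho> (\<sigma> (\<kappa> n))) - s (\<rho> (\<sigma> (\<kappa> n)))) \<longlonglongrightarrow> t"
      unfolding o_def \<delta>_def by blast
    have "(\<lambda>n. W (s (\<rho> (\<sigma> (\<kappa> n))) + t)) \<longlonglongrightarrow> z t"
      using LIMSEQ_subseq_LIMSEQ[OF lim strict_mono_o[OF \<sigma>(1) \<kappa>]] by (simp add: o_def)
    from tendsto_lipschitz_shift[OF lipschitz this t_lim]
    have "(\<lambda>n. f (q (\<rho> (\<sigma> (\<kappa> n))))) \<longlonglongrightarrow> \<phi> (z t)"
      unfolding f_def by (intro \<phi>_lim) simp
    then have "b \<le> \<phi> (z t)" by (rule LIMSEQ_le_const) (use fq in blast)
    then show False using below[OF t] \<open>a < b\<close> by linarith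
  qed
  \<comment> \<open>Time \<open>T\<close> after the crossing still lies before \<open>q\<close>,
    where \<open>f\<close> exceeds \<open>a\<close>. The limit preserves
    \<open>a \<le> \<phi> (z T)\<close>, which contradicts the strict descent.\<close>
  then have "\<forall>\<^sub>F n in sequentially. a \<le> f (s (\<rho> n) + T)"
  proof eventually_elim
    case (elim n)
    then show ?case using above[of "\<rho> n" "s (\<rho> n) + T"] \<open>T > 0\<close> by simp
  qed
  then have "a \<le> \<phi> (z T)" using tendsto_lowerbound[OF f_lim] by auto
  then show False using T by linarith
qed

section \<open>Convergence of the iterates\<close>

text \<open>Greedy selection: if each new \<open>y (r n) - w\<close> has inner product at most 1 with the sum of the
  previous ones, that sum has norm \<open>O (sqrt n)\<close>.\<close>

lemma cesaro_selection:
  fixes x :: "nat \<Rightarrow> 'b::metric_space" and y :: "nat \<Rightarrow> 'a::real_inner"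
  assumes bd: "bounded (y ` {1..})"
    and steer: "\<And>d e N. e > 0 \<Longrightarrow> \<exists>k>N. dist (x k) p < e \<and> d \<bullet> (y k - w) \<le> e"
  obtains r :: "nat \<Rightarrow> nat" where "strict_mono r" "\<And>j. j \<ge> 1 \<Longrightarrow> r j \<ge> 1" "(\<lambda>j. x (r j)) \<longlonglongrightarrow> p"
    "(\<lambda>n. (1 / real n) *\<^sub>R (\<Sum>j=1..n. y (r j))) \<longlonglongrightarrow> w"
proof -
  obtain B where B: "\<And>k. k \<ge> 1 \<Longrightarrow> norm (y k) \<le> B"
    using bd by (auto simp: bounded_iff)
  define C where "C = B + norm w"
  have C: "norm (y k - w) \<le> C" if "k \<ge> 1" for k
    using B[OF that] norm_triangle_ineq4[of "y k" w] by (simp add: C_def)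
  \<comment> \<open>A state holds the index chosen last and the running sum of \<open>y - w\<close>;
    \<open>Q\<close> is the transition. The start \<open>(0, 0)\<close> is a placeholder: genuine
    indices begin with \<open>r 1\<close>.\<close>
  define Q where "Q n a b \<longleftrightarrow> fst a < fst b \<and> dist (x (fst b)) p < 1 / real (Suc n) \<and>
      snd a \<bullet> (y (fst b) - w) \<le> 1 \<and> snd b = snd a + (y (fst b) - w)" for n and a b :: "nat \<times> 'a"
  have "\<exists>f. \<forall>n. (n = 0 \<longrightarrow> f n = (0, 0)) \<and> Q n (f n) (f (Suc n))"
  proof (rule dependent_nat_choice)
    fix a :: "nat \<times> 'a" and n
    obtain k where k: "k > fst a" "dist (x k) p < 1 / real (Suc n)" "snd a \<bullet> (y k - w) \<le> 1 / real (Suc n)"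
      using steer[of "1 / real (Suc n)" "fst a" "snd a"] by auto
    have "1 / real (Suc n) \<le> 1" by simp
    with k(3) have "snd a \<bullet> (y k - w) \<le> 1" by (rule order_trans)
    then have "Q n a (k, snd a + (y k - w))" using k by (simp add: Q_def)
    then show "\<exists>b. (Suc n = 0 \<longrightarrow> b = (0, 0)) \<and> Q n a b" by blast
  qed simp
  then obtain f where f0: "f 0 = (0, 0)" and fQ: "\<And>n. Q n (f n) (f (Suc n))" by blast
  define r where "r n = fst (f n)" for n
  define S where "S n = snd (f n)" for n
  have step: "r n < r (Suc n)" "dist (x (r (Suc n))) p < 1 / real (Suc n)"
      "S n \<bullet> (y (r (Suc n)) - w) \<le> 1" "S (Suc n) = S n + (y (r (Suc n)) - w)" for n
    using fQ[of n] by (auto simp: Q_def r_def S_def)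
  have "strict_mono r" using step(1) by (simp add: strict_mono_Suc_iff)
  have r1: "r j \<ge> 1" if "j \<ge> 1" for j
    using \<open>strict_mono r\<close> that by (metis strict_mono_imp_increasing order_trans)
  have S_sum: "S n = (\<Sum>j=1..n. y (r j)) - real n *\<^sub>R w" for n
  proof (induction n)
    case 0 then show ?case by (simp add: S_def f0)
  next
    case (Suc n) then show ?case by (simp add: step(4) algebra_simps)
  qed
  \<comment> \<open>In the expanded square the cross term adds at most 2 and the new term at most
    \<open>C\<^sup>2\<close>. Dividing by \<open>n\<close> leaves an average error of order
    \<open>1 / sqrt n\<close>.\<close>
  have S_bound: "(norm (S n))\<^sup>2 \<le> real n * (C\<^sup>2 + 2)" for n
  proof (induction n)
    case 0 then show ?case by (simp add: S_def f0)
  next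
    case (Suc n)
    let ?v = "y (r (Suc n)) - w"
    have "(norm (S (Suc n)))\<^sup>2 = (norm (S n))\<^sup>2 + 2 * (S n \<bullet> ?v) + (norm ?v)\<^sup>2"
      by (simp add: step(4) power2_norm_eq_inner inner_add_left inner_add_right inner_commute)
    moreover have "(norm ?v)\<^sup>2 \<le> C\<^sup>2" using C[OF r1[of "Suc n"]] by (intro power_mono) auto
    ultimately show ?case using Suc step(3)[of n] by (simp add: algebra_simps)
  qed
  have "(\<lambda>j. x (r (Suc j))) \<longlonglongrightarrow> p"
  proof (rule metric_tendsto_imp_tendsto)
    show "(\<lambda>n. 1 / real (Suc n)) \<longlonglongrightarrow> 0" using LIMSEQ_Suc[OF lim_1_over_n] by simp
    show "\<forall>\<^sub>F n in sequentially. dist (x (r (Suc n))) p \<le> dist (1 / real (Suc n)) 0"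
      using step(2) by (auto simp: less_imp_le dist_real_def)
  qed
  then have "(\<lambda>j. x (r j)) \<longlonglongrightarrow> p" by (rule LIMSEQ_imp_Suc)
  moreover have "(\<lambda>n. (1 / real n) *\<^sub>R (\<Sum>j=1..n. y (r j))) \<longlonglongrightarrow> w"
  proof (rule metric_tendsto_imp_tendsto)
    show "(\<lambda>n. sqrt ((C\<^sup>2 + 2) * (1 / real n))) \<longlonglongrightarrow> 0"
      using tendsto_real_sqrt[OF tendsto_mult_right_zero[OF lim_1_over_n, of "C\<^sup>2 + 2"]] by simp
    show "\<forall>\<^sub>F n in sequentially. dist ((1 / real n) *\<^sub>R (\<Sum>j=1..n. y (r j))) w
        \<le> dist (sqrt ((C\<^sup>2 + 2) * (1 / real n))) 0"
      using eventually_gt_at_top[of 0]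
    proof eventually_elim
      case (elim n)
      have "dist ((1 / real n) *\<^sub>R (\<Sum>j=1..n. y (r j))) w = norm ((1 / real n) *\<^sub>R S n)"
        using elim by (simp add: S_sum dist_norm scaleR_diff_right)
      also have "\<dots> = sqrt ((norm (S n))\<^sup>2 / (real n)\<^sup>2)" by (simp add: real_sqrt_divide)
      also have "\<dots> \<le> sqrt (real n * (C\<^sup>2 + 2) / (real n)\<^sup>2)"
        using S_bound[of n] by (intro real_sqrt_le_mono divide_right_mono) auto
      also have "real n * (C\<^sup>2 + 2) / (real n)\<^sup>2 = (C\<^sup>2 + 2) * (1 / real n)"
        using elim by (simp add: power2_eq_square)
      finally show ?case by simp
    qed
  qed
  ultimately show thesis using that \<open>strict_mono r\<close> r1 by blast
qed

theorem theorem3p2: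
  fixes X :: "'a::euclidean_space set"
    and G :: "'a \<Rightarrow> 'a set"
    and x y \<xi> :: "nat \<Rightarrow> 'a"
    and \<alpha> :: "nat \<Rightarrow> real"
    and v :: 'a
    and \<phi> :: "'a \<Rightarrow> real"
  assumes "closed X"
    and "\<forall>k\<ge>1. \<alpha> k > 0"
    and "\<forall>k\<ge>1. x (k + 1) = x k + \<alpha> k *\<^sub>R (y k + \<xi> k)"
    and "\<forall>p. limit_point x p \<longrightarrow> p \<in> X"
    and "bounded (x ` {1..})" and "bounded (y ` {1..})"
    and "filterlim (\<lambda>n. \<Sum>k=1..n. \<alpha> k) at_top sequentially"
    and "summable (\<lambda>k. (\<alpha> k)\<^sup>2)"
    and "(\<lambda>n. \<Sum>k=1..n. \<alpha> k *\<^sub>R \<xi> k) \<longlonglongrightarrow> v"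
    and "\<forall>r xbar. strict_mono r \<and> (\<forall>j\<ge>1. r j \<ge> 1) \<and> (\<lambda>j. x (r j)) \<longlonglongrightarrow> xbar \<longrightarrow>
           dist_attained (G xbar) \<and>
           (\<lambda>n. infdist ((1 / real n) *\<^sub>R (\<Sum>j=1..n. y (r j))) (G xbar)) \<longlonglongrightarrow> 0"
    and "continuous_on UNIV \<phi>" and "bdd_below (range \<phi>)"
    and "closure {s::real. \<phi> -` {s} \<inter> setval_inverse X G 0 = {}} = UNIV"
    and "\<forall>z. trajectory X G z \<and> 0 \<notin> G (z 0) \<longrightarrow>
           (\<exists>T>0. \<phi> (z T) < (SUP t\<in>{0..T}. \<phi> (z t)) \<and> (SUP t\<in>{0..T}. \<phi> (z t)) \<le> \<phi> (z 0))"
  shows "(\<forall>p. limit_point x p \<longrightarrow> p \<in> setval_inverse X G 0) \<and> convergent (\<lambda>k. \<phi> (x k))"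
proof -
  have "(\<lambda>k. sqrt ((\<alpha> k)\<^sup>2)) \<longlonglongrightarrow> sqrt 0"
    by (intro tendsto_real_sqrt summable_LIMSEQ_zero assms)
  then have null: "\<alpha> \<longlonglongrightarrow> 0" by (simp add: tendsto_rabs_zero_iff)
  obtain W m L \<tau> where interp: "interpolation x y W m L" and \<tau>: "filterlim \<tau> at_top sequentially"
    and m\<tau>: "\<And>k. k \<ge> 1 \<Longrightarrow> m (\<tau> k) = k"
    by (rule interpolation_exists[of \<alpha> x y \<xi> v]) (use assms null in auto)
  interpret interpolation x y W m L by (rule interp)
  \<comment> \<open>The averages along the selected subsequence tend to \<open>w\<close>, while
    their distance to \<open>G p\<close> tends to 0. As \<open>infdist\<close> is continuous and
    \<open>G p\<close> closed, \<open>w\<close> belongs to it.\<close>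
  have G: "w \<in> G p" if steer: "\<And>d e N. e > 0 \<Longrightarrow> \<exists>k>N. dist (x k) p < e \<and> d \<bullet> (y k - w) \<le> e" for p w
  proof -
    obtain r :: "nat \<Rightarrow> nat" where r: "strict_mono r" "\<And>j. j \<ge> 1 \<Longrightarrow> r j \<ge> 1" "(\<lambda>j. x (r j)) \<longlonglongrightarrow> p"
      and w: "(\<lambda>n. (1 / real n) *\<^sub>R (\<Sum>j=1..n. y (r j))) \<longlonglongrightarrow> w"
      using cesaro_selection[OF assms(6) steer] by metis
    then have "closed (G p)" "G p \<noteq> {}"
      and "(\<lambda>n. infdist ((1 / real n) *\<^sub>R (\<Sum>j=1..n. y (r j))) (G p)) \<longlonglongrightarrow> 0"
      using assms(10) by (auto simp: dist_attained_iff)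
    moreover have "(\<lambda>n. infdist ((1 / real n) *\<^sub>R (\<Sum>j=1..n. y (r j))) (G p)) \<longlonglongrightarrow> infdist w (G p)"
      by (intro tendsto_infdist w)
    ultimately have "infdist w (G p) = 0" using LIMSEQ_unique by blast
    then show ?thesis using \<open>closed (G p)\<close> \<open>G p \<noteq> {}\<close> by (simp add: in_closed_iff_infdist_zero)
  qed
  have X: "p \<in> X" if "limit_point x p" for p using assms(4) that by blast
  have descent: "\<exists>T>0. \<phi> (z T) < (SUP t\<in>{0..T}. \<phi> (z t)) \<and> (SUP t\<in>{0..T}. \<phi> (z t)) \<le> \<phi> (z 0)"
    if "trajectory X G z" "0 \<notin> G (z 0)" for z using assms(14) that by blast
  obtain c where c: "((\<lambda>t. \<phi> (W t)) \<longlongrightarrow> c) at_top"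
    using lyapunov_converges[OF X G assms(11,13) descent] by blast
  have W\<tau>: "(\<lambda>k. W (\<tau> k) - x k) \<longlonglongrightarrow> 0"
  proof (rule Lim_transform_eventually)
    show "(\<lambda>k. W (\<tau> k) - x (m (\<tau> k))) \<longlonglongrightarrow> 0" using filterlim_compose[OF approx \<tau>] .
    show "\<forall>\<^sub>F k in sequentially. W (\<tau> k) - x (m (\<tau> k)) = W (\<tau> k) - x k"
      using eventually_ge_at_top[of 1] by eventually_elim (simp add: m\<tau>)
  qed
  have "p \<in> setval_inverse X G 0" if "limit_point x p" for p
  proof -
    obtain r where r: "strict_mono r" "(\<lambda>j. x (r j)) \<longlonglongrightarrow> p"
      using \<open>limit_point x p\<close> by (auto simp: limit_point_def)
    have Wp: "(\<lambda>j. W (\<tau> (r j))) \<longlonglongrightarrow> p"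
      using tendsto_add[OF LIMSEQ_subseq_LIMSEQ[OF W\<tau> r(1)] r(2)] by (simp add: o_def)
    obtain \<rho> z where \<rho>: "strict_mono (\<rho> :: nat \<Rightarrow> nat)" and lipz: "L-lipschitz_on UNIV z"
      and lim: "\<And>t. (\<lambda>n. W (\<tau> (r (\<rho> n)) + t)) \<longlonglongrightarrow> z t"
      using lipschitz_shift_subsequence[OF lipschitz bounded_range, of "\<lambda>n. \<tau> (r n)"] by metis
    have top: "filterlim (\<lambda>n. \<tau> (r (\<rho> n))) at_top sequentially"
      using filterlim_compose[OF \<tau> filterlim_subseq[OF strict_mono_o[OF r(1) \<rho>]]] by (simp add: o_def)
    from shift_limit_trajectory[OF top lim lipz X G]
    have traj: "trajectory X G z" .
    have z0: "z 0 = p"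
      using LIMSEQ_unique[OF lim[of 0]] LIMSEQ_subseq_LIMSEQ[OF Wp \<rho>] by (simp add: o_def)
    \<comment> \<open>The shifted times tend to infinity for each fixed \<open>t\<close>, so the
      limit \<open>c\<close> of \<open>\<phi>\<close> along \<open>W\<close> is its value on all of
      \<open>z\<close>. A constant cannot lie strictly below its supremum.\<close>
    have const: "\<phi> (z t) = c" for t
    proof (rule LIMSEQ_unique)
      show "(\<lambda>n. \<phi> (W (\<tau> (r (\<rho> n)) + t))) \<longlonglongrightarrow> \<phi> (z t)"
        using continuous_on_tendsto_compose[OF assms(11) lim] by simp
      have "filterlim (\<lambda>n. \<tau> (r (\<rho> n)) + t) at_top sequentially"
        using filterlim_tendsto_add_at_top[OF tendsto_const top, of t] by (simp add: add.commute)
      from filterlim_compose[OF c this] show "(\<lambda>n. \<phi> (W (\<tau> (r (\<rho> n)) + t))) \<longlonglongrightarrow> c" .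
    qed
    have "0 \<in> G p"
    proof (rule ccontr)
      assume "0 \<notin> G p"
      then obtain T where "T > 0" "\<phi> (z T) < (SUP t\<in>{0..T}. \<phi> (z t))"
        using descent[OF traj] z0 by blast
      then show False by (simp add: const)
    qed
    then show ?thesis using X[OF \<open>limit_point x p\<close>] by (simp add: setval_inverse_def)
  qed
  moreover have "convergent (\<lambda>k. \<phi> (x k))"
  proof -
    \<comment> \<open>Uniform continuity is needed because neither \<open>W (\<tau> k)\<close> nor
      \<open>x k\<close> need converge. The index is shifted to \<open>Suc k\<close> since
      \<open>x 0\<close> is unconstrained.\<close>
    let ?K = "closure (range W \<union> x ` {1..})"
    have "compact ?K" using bounded_range assms(5) by auto
    then have "uniformly_continuous_on ?K \<phi>"
      using compact_uniformly_continuous continuous_on_subset[OF assms(11)] by blast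
    moreover have "(\<lambda>k. dist (W (\<tau> (Suc k))) (x (Suc k))) \<longlonglongrightarrow> 0"
      using LIMSEQ_Suc[OF tendsto_norm_zero[OF W\<tau>]] by (simp add: dist_norm)
    moreover have "W (\<tau> (Suc k)) \<in> ?K" "x (Suc k) \<in> ?K" for k
      by (rule subsetD[OF closure_subset]; simp)+
    ultimately have "(\<lambda>k. dist (\<phi> (W (\<tau> (Suc k)))) (\<phi> (x (Suc k)))) \<longlonglongrightarrow> 0"
      unfolding uniformly_continuous_on_sequentially
      by (auto dest!: spec[of _ "\<lambda>k. W (\<tau> (Suc k))"] spec[of _ "\<lambda>k. x (Suc k)"])
    then have "(\<lambda>k. \<phi> (W (\<tau> (Suc k))) - \<phi> (x (Suc k))) \<longlonglongrightarrow> 0"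
      by (simp add: dist_real_def tendsto_rabs_zero_iff)
    from tendsto_diff[OF LIMSEQ_Suc[OF filterlim_compose[OF c \<tau>]] this]
    have "(\<lambda>k. \<phi> (x (Suc k))) \<longlonglongrightarrow> c" by simp
    then have "(\<lambda>k. \<phi> (x k)) \<longlonglongrightarrow> c" by (rule LIMSEQ_imp_Suc)
    then show ?thesis by (rule convergentI)
  qed
  ultimately show ?thesis by blast
qed

end
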